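(* Let $G$ be a semigroup (with identity) and let $f:G\to\mathbb{C}$ be a bounded function. Then any two topological Furstenberg systems of $f$ are topologically isomorphic. Moreover, any Furstenberg system of $f$ is a factor of any generalised Furstenberg system of $f$, and there exists a (maximal) generalised Furstenberg system of $f$ such that every generalised Furstenberg system of $f$ is a factor of it.
   Context: Semigroups are discrete and contain an identity element $e$ (one is adjoined if necessary). A topological dynamical $G$-system $(X,(T_g)_{g\in G})$ is a compact Hausdorff space $X$ together with continuous maps $T_g:X\to X$, $g\in G$, such that $T_{gh}=T_gT_h$ for all $g,h\in G$ and $T_e=\mathrm{id}_X$. A point $a\in X$ is transitive if $\{T_ga:g\in G\}$ is dense in $X$. Let $f:G\to\mathbb{C}$ be bounded. A $G$-system $(X,(T_g))$ is a topological Furstenberg system of $f$ if (i) there exist $F\in C(X)$ (continuous complex-valued) and a transitive point $a\in X$ with $f(g)=F(T_ga)$ for all $g\in G$, and (ii) for any $x\neq y$ in $X$ there is $g\in G$ with $F(T_gx)\neq F(T_gy)$. If condition (ii) is dropped, the system is called a generalised Furstenberg system of $f$. A factor map from $(X,(T_g))$ to $(Y,(S_g))$ is a continuous surjection $\phi:X\to Y$ with $\phi\circ T_g=S_g\circ\phi$ for all $g\in G$; then $(Y,(S_g))$ is called a factor of $(X,(T_g))$. A topological isomorphism is a homeomorphism $\phi:X\to Y$ with $\phi\circ T_g=S_g\circ\phi$ for all $g\in G$. *)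

theory Defs
  imports "HOL-Analysis.Analysis"
begin

text \<open>
  The acting semigroup with identity is a type of class \<open>monoid_mult\<close>. A phase space is a
  \<open>'x topology\<close>, whose set of points is \<open>topspace X\<close>; the maps \<open>T g\<close> are total functions on \<open>'x\<close>
  that matter only on \<open>topspace X\<close>.
\<close>

definition dynamical_system :: "'x topology \<Rightarrow> ('g::monoid_mult \<Rightarrow> 'x \<Rightarrow> 'x) \<Rightarrow> bool" where
  "dynamical_system X T \<longleftrightarrow>
     compact_space X \<and> Hausdorff_space X \<and>
     (\<forall>g. continuous_map X X (T g)) \<and>
     (\<forall>g h. \<forall>x\<in>topspace X. T (g * h) x = T g (T h x)) \<and>
     (\<forall>x\<in>topspace X. T 1 x = x)"

definition transitive_point :: "'x topology \<Rightarrow> ('g \<Rightarrow> 'x \<Rightarrow> 'x) \<Rightarrow> 'x \<Rightarrow> bool" where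
  "transitive_point X T a \<longleftrightarrow>
     a \<in> topspace X \<and> X closure_of (range (\<lambda>g. T g a)) = topspace X"

definition represents ::
  "('g \<Rightarrow> complex) \<Rightarrow> 'x topology \<Rightarrow> ('g \<Rightarrow> 'x \<Rightarrow> 'x) \<Rightarrow> ('x \<Rightarrow> complex) \<Rightarrow> 'x \<Rightarrow> bool" where
  "represents f X T F a \<longleftrightarrow>
     continuous_map X euclidean F \<and> transitive_point X T a \<and> (\<forall>g. f g = F (T g a))"

definition generalised_Furstenberg_system ::
  "('g::monoid_mult \<Rightarrow> complex) \<Rightarrow> 'x topology \<Rightarrow> ('g \<Rightarrow> 'x \<Rightarrow> 'x) \<Rightarrow> bool" where
  "generalised_Furstenberg_system f X T \<longleftrightarrow>
     dynamical_system X T \<and> (\<exists>F a. represents f X T F a)"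

definition Furstenberg_system ::
  "('g::monoid_mult \<Rightarrow> complex) \<Rightarrow> 'x topology \<Rightarrow> ('g \<Rightarrow> 'x \<Rightarrow> 'x) \<Rightarrow> bool" where
  "Furstenberg_system f X T \<longleftrightarrow>
     dynamical_system X T \<and>
     (\<exists>F a. represents f X T F a \<and>
        (\<forall>x\<in>topspace X. \<forall>y\<in>topspace X. x \<noteq> y \<longrightarrow> (\<exists>g. F (T g x) \<noteq> F (T g y))))"

definition factor_map ::
  "'x topology \<Rightarrow> ('g \<Rightarrow> 'x \<Rightarrow> 'x) \<Rightarrow> 'y topology \<Rightarrow> ('g \<Rightarrow> 'y \<Rightarrow> 'y) \<Rightarrow> ('x \<Rightarrow> 'y) \<Rightarrow> bool" where
  "factor_map X T Y S \<phi> \<longleftrightarrow>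
     continuous_map X Y \<phi> \<and> \<phi> ` topspace X = topspace Y \<and>
     (\<forall>g. \<forall>x\<in>topspace X. \<phi> (T g x) = S g (\<phi> x))"

definition is_factor_of ::
  "'y topology \<Rightarrow> ('g \<Rightarrow> 'y \<Rightarrow> 'y) \<Rightarrow> 'x topology \<Rightarrow> ('g \<Rightarrow> 'x \<Rightarrow> 'x) \<Rightarrow> bool" where
  "is_factor_of Y S X T \<longleftrightarrow> (\<exists>\<phi>. factor_map X T Y S \<phi>)"

definition topologically_isomorphic ::
  "'x topology \<Rightarrow> ('g \<Rightarrow> 'x \<Rightarrow> 'x) \<Rightarrow> 'y topology \<Rightarrow> ('g \<Rightarrow> 'y \<Rightarrow> 'y) \<Rightarrow> bool" where
  "topologically_isomorphic X T Y S \<longleftrightarrow>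
     (\<exists>\<phi>. homeomorphic_map X Y \<phi> \<and> (\<forall>g. \<forall>x\<in>topspace X. \<phi> (T g x) = S g (\<phi> x)))"

text \<open>
  A formula of HOL cannot quantify over all types, so maximality is relative to a type \<open>'y\<close>:
  \<open>(M, R)\<close> has as factors all generalised Furstenberg systems whose points are in \<open>'y\<close>.
  For a function on \<open>'g\<close> the type \<open>'g set set\<close> is large enough: a compact Hausdorff space
  in which an image of \<open>'g\<close> is dense has at most as many points as \<open>'g set set\<close> has elements.
  To say that one and the same system is maximal for every type, assert that some system
  is maximal relative to \<open>'g set set\<close>, where no other type occurs, and that a system with this
  property is maximal relative to an arbitrary \<open>'y\<close>.
\<close>

definition maximal_generalised_Furstenberg_system ::
  "'y itself \<Rightarrow> ('g::monoid_mult \<Rightarrow> complex) \<Rightarrow> 'm topology \<Rightarrow> ('g \<Rightarrow> 'm \<Rightarrow> 'm) \<Rightarrow> bool" where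
  "maximal_generalised_Furstenberg_system _ f M R \<longleftrightarrow>
     generalised_Furstenberg_system f M R \<and>
     (\<forall>(Y :: 'y topology) S. generalised_Furstenberg_system f Y S \<longrightarrow> is_factor_of Y S M R)"

end

theory Submission
  imports Defs
begin

text \<open>
  Let \<open>a\<close> and \<open>b\<close> be transitive points of \<open>X\<close> and \<open>Y\<close>. If the closure of \<open>{(T g a, S g b) | g}\<close> in
  \<open>X \<times> Y\<close> is single-valued over \<open>X\<close>, then, \<open>Y\<close> being compact, it is the graph of a continuous map,
  which by density is a factor map. When \<open>Y\<close> is a Furstenberg system and \<open>F'\<close>, \<open>F\<close> represent \<open>f\<close> on
  \<open>X\<close>, \<open>Y\<close>, every \<open>(x, y)\<close> in this closure satisfies \<open>F (S g y) = F' (T g x)\<close> for all \<open>g\<close>, so \<open>y\<close> is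
  determined by \<open>x\<close>; if \<open>X\<close> is a Furstenberg system too, the factor map is injective. The maximal
  system is the Stone-Cech compactification of the discrete semigroup with the action extending
  left multiplication.
\<close>

section \<open>Factor maps from closures of graphs on orbits\<close>

text \<open>Compactness of \<open>Y\<close> makes the projection to \<open>X\<close> a closed map.
  This is used twice: the closure projects onto a closed set containing the dense range of
  \<open>u\<close>, so the graph is total, and the preimage of a closed \<open>C\<close> is the
  projection of the closed part of the graph over \<open>C\<close>.\<close>

lemma continuous_extension_of_single_valued_closure:
  assumes Y: "compact_space Y"
    and u: "range u \<subseteq> topspace X" "X closure_of range u = topspace X"
    and v: "range v \<subseteq> topspace Y"
    and single: "\<And>x y y'.
      (x, y) \<in> prod_topology X Y closure_of range (\<lambda>i. (u i, v i)) \<Longrightarrow>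
      (x, y') \<in> prod_topology X Y closure_of range (\<lambda>i. (u i, v i)) \<Longrightarrow> y = y'"
  obtains \<phi> where "continuous_map X Y \<phi>" "\<And>i. \<phi> (u i) = v i"
proof -
  define Z where "Z = prod_topology X Y closure_of range (\<lambda>i. (u i, v i))"
  have Z: "closedin (prod_topology X Y) Z"
    by (simp add: Z_def)
  have uv: "(u i, v i) \<in> Z" for i
    using u(1) v closure_of_subset[of "range (\<lambda>i. (u i, v i))" "prod_topology X Y"]
    unfolding Z_def by fastforce
  have proj: "closedin X (fst ` (Z \<inter> topspace X \<times> C))" if "closedin Y C" for C
    using closed_map_fst[OF Y, of X] Z that
    unfolding closed_map_def by (simp add: closedin_Int closedin_prod_Times_iff)
  have "topspace X \<subseteq> fst ` Z"
  proof -
    have "closedin X (fst ` Z)"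
      using closed_map_fst[OF Y, of X] Z unfolding closed_map_def by blast
    moreover have "range u \<subseteq> fst ` Z"
      using uv by force
    ultimately show ?thesis
      using u(2) closure_of_minimal by metis
  qed
  then have "\<forall>x\<in>topspace X. \<exists>y. (x, y) \<in> Z"
    by force
  then obtain \<phi> where \<phi>: "\<And>x. x \<in> topspace X \<Longrightarrow> (x, \<phi> x) \<in> Z"
    by metis
  have Z_iff: "(x, y) \<in> Z \<longleftrightarrow> y = \<phi> x" if "x \<in> topspace X" for x y
    using \<phi>[OF that] single unfolding Z_def by blast
  have Zsub: "Z \<subseteq> topspace X \<times> topspace Y"
    using closedin_subset[OF Z] by simp
  have "continuous_map X Y \<phi>"
    unfolding continuous_map_closedin
  proof (intro conjI allI impI)
    show "\<phi> \<in> topspace X \<rightarrow> topspace Y"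
      using \<phi> Zsub by blast
    fix C assume C: "closedin Y C"
    have "{x \<in> topspace X. \<phi> x \<in> C} = fst ` (Z \<inter> topspace X \<times> C)"
      using \<phi> Z_iff by force
    then show "closedin X {x \<in> topspace X. \<phi> x \<in> C}"
      using proj[OF C] by simp
  qed
  moreover have "\<phi> (u i) = v i" for i
    using uv Z_iff u(1) by (metis range_subsetD)
  ultimately show thesis
    using that by blast
qed

lemma dynamical_system_in_topspace:
  assumes "dynamical_system X T" "x \<in> topspace X"
  shows "T g x \<in> topspace X"
proof -
  have "continuous_map X X (T g)"
    using assms(1) by (simp add: dynamical_system_def)
  from continuous_map_image_subset_topspace[OF this] show ?thesis
    using assms(2) by blast
qed

text \<open>Everything passes from the orbit to its closure: the image of \<phi> is compact, hence
  closed, and contains the dense orbit of \<open>b\<close>; equivariance holds on the orbit by the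
  action law.\<close>

lemma factor_map_from_orbit_correspondence:
  assumes X: "dynamical_system X T" "transitive_point X T a"
    and Y: "dynamical_system Y S" "transitive_point Y S b"
    and \<phi>: "continuous_map X Y \<phi>" "\<And>g. \<phi> (T g a) = S g b"
  shows "factor_map X T Y S \<phi>"
  unfolding factor_map_def
proof (intro conjI allI ballI)
  have a: "a \<in> topspace X" and densa: "X closure_of range (\<lambda>g. T g a) = topspace X"
    and b: "b \<in> topspace Y" and densb: "Y closure_of range (\<lambda>g. S g b) = topspace Y"
    using X(2) Y(2) by (auto simp: transitive_point_def)
  have XT: "compact_space X" "\<And>g. continuous_map X X (T g)"
      "\<And>g h x. x \<in> topspace X \<Longrightarrow> T (g * h) x = T g (T h x)"
    and YS: "Hausdorff_space Y" "\<And>g. continuous_map Y Y (S g)"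
      "\<And>g h y. y \<in> topspace Y \<Longrightarrow> S (g * h) y = S g (S h y)"
    using X(1) Y(1) by (auto simp: dynamical_system_def)
  have orbit: "T g a \<in> topspace X" for g
    using X(1) a by (rule dynamical_system_in_topspace)
  show "continuous_map X Y \<phi>" by fact
  show "\<phi> ` topspace X = topspace Y"
  proof
    show "\<phi> ` topspace X \<subseteq> topspace Y"
      using \<phi>(1) by (rule continuous_map_image_subset_topspace)
    have "closedin Y (\<phi> ` topspace X)"
      using XT(1) YS(1) \<phi>(1)
      by (meson compact_space_def compactin_imp_closedin image_compactin)
    moreover have "range (\<lambda>g. S g b) \<subseteq> \<phi> ` topspace X"
      using \<phi>(2) orbit by (metis image_eqI image_subsetI)
    ultimately show "topspace Y \<subseteq> \<phi> ` topspace X"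
      using densb closure_of_minimal by metis
  qed
  fix g x assume "x \<in> topspace X"
  have "(\<phi> \<circ> T g) x = (S g \<circ> \<phi>) x"
  proof (rule forall_in_closure_of_eq[where X = X and Y = Y and f = "\<phi> \<circ> T g" and g = "S g \<circ> \<phi>"])
    show "x \<in> X closure_of range (\<lambda>g. T g a)"
      using densa \<open>x \<in> topspace X\<close> by simp
    show "Hausdorff_space Y" by fact
    show "continuous_map X Y (\<phi> \<circ> T g)"
      using XT(2) \<phi>(1) by (rule continuous_map_compose)
    show "continuous_map X Y (S g \<circ> \<phi>)"
      using \<phi>(1) YS(2) by (rule continuous_map_compose)
    show "(\<phi> \<circ> T g) z = (S g \<circ> \<phi>) z" if "z \<in> range (\<lambda>g. T g a)" for z
    proof -
      obtain h where "z = T h a"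
        using \<open>z \<in> range (\<lambda>g. T g a)\<close> by blast
      then show ?thesis
        using \<phi>(2)[of "g * h"] \<phi>(2)[of h] XT(3)[OF a] YS(3)[OF b] by simp
    qed
  qed
  then show "\<phi> (T g x) = S g (\<phi> x)"
    by simp
qed

text \<open>The second conclusion, that the map carries one representing function to the other,
  later yields injectivity between two separated systems.\<close>

lemma factor_map_onto_separated_system:
  assumes Y: "dynamical_system Y S" "represents f Y S F' b"
    and X: "dynamical_system X T" "represents f X T F a"
    and sep: "\<And>x y. x \<in> topspace X \<Longrightarrow> y \<in> topspace X \<Longrightarrow> x \<noteq> y \<Longrightarrow>
      \<exists>g. F (T g x) \<noteq> F (T g y)"
  obtains \<phi> where "factor_map Y S X T \<phi>" "\<And>y. y \<in> topspace Y \<Longrightarrow> F (\<phi> y) = F' y"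
proof -
  have a: "transitive_point X T a" "a \<in> topspace X" and b: "transitive_point Y S b" "b \<in> topspace Y"
    and densb: "Y closure_of range (\<lambda>g. S g b) = topspace Y"
    and F: "continuous_map X euclidean F" "\<And>g. F (T g a) = f g"
    and F': "continuous_map Y euclidean F'" "\<And>g. F' (S g b) = f g"
    using X(2) Y(2) by (auto simp: represents_def transitive_point_def)
  have XT: "compact_space X" "\<And>g. continuous_map X X (T g)"
      "\<And>g h x. x \<in> topspace X \<Longrightarrow> T (g * h) x = T g (T h x)"
    and YS: "\<And>g. continuous_map Y Y (S g)"
      "\<And>g h y. y \<in> topspace Y \<Longrightarrow> S (g * h) y = S g (S h y)"
    using X(1) Y(1) by (auto simp: dynamical_system_def)
  let ?P = "prod_topology Y X" and ?D = "range (\<lambda>g. (S g b, T g a))"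
  \<comment> \<open>At the orbit pair \<open>(S h b, T h a)\<close> both sides equal
    \<open>f (g * h)\<close>; both are continuous, so equality extends to the closure.\<close>
  have agree: "F (T g x) = F' (S g y)" if "(y, x) \<in> ?P closure_of ?D" for g x y
  proof -
    have "(F \<circ> (T g \<circ> snd)) (y, x) = (F' \<circ> (S g \<circ> fst)) (y, x)"
    proof (rule forall_in_closure_of_eq[OF that])
      show "Hausdorff_space (euclidean :: complex topology)"
        by (rule Hausdorff_space_euclidean)
      show "continuous_map ?P euclidean (F \<circ> (T g \<circ> snd))"
        by (rule continuous_map_compose[OF continuous_map_compose[OF continuous_map_snd XT(2)] F(1)])
      show "continuous_map ?P euclidean (F' \<circ> (S g \<circ> fst))"
        by (rule continuous_map_compose[OF continuous_map_compose[OF continuous_map_fst YS(1)] F'(1)])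
      show "(F \<circ> (T g \<circ> snd)) z = (F' \<circ> (S g \<circ> fst)) z" if "z \<in> ?D" for z
      proof -
        obtain h where "z = (S h b, T h a)"
          using \<open>z \<in> ?D\<close> by blast
        then show ?thesis
          using F(2)[of "g * h"] F'(2)[of "g * h"] XT(3)[OF a(2)] YS(2)[OF b(2)] by simp
      qed
    qed
    then show ?thesis by simp
  qed
  have inspace: "x \<in> topspace X" if "(y, x) \<in> ?P closure_of ?D" for x y
    using closure_of_subset_topspace[of ?P ?D] that by auto
  obtain \<phi> where \<phi>: "continuous_map Y X \<phi>" "\<And>g. \<phi> (S g b) = T g a"
  proof (rule continuous_extension_of_single_valued_closure[OF XT(1) _ densb])
    show "range (\<lambda>g. S g b) \<subseteq> topspace Y" "range (\<lambda>g. T g a) \<subseteq> topspace X"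
      using dynamical_system_in_topspace[OF X(1) a(2)] dynamical_system_in_topspace[OF Y(1) b(2)]
      by auto
    show "x = x'" if "(y, x) \<in> ?P closure_of ?D" "(y, x') \<in> ?P closure_of ?D" for y x x'
      using sep[OF inspace[OF that(1)] inspace[OF that(2)]] agree[OF that(1)] agree[OF that(2)]
      by auto
  qed (rule that)
  have "F (\<phi> y) = F' y" if "y \<in> topspace Y" for y
  proof -
    have "y \<in> Y closure_of range (\<lambda>g. S g b)"
      using densb that by simp
    moreover have "(F \<circ> \<phi>) z = F' z" if "z \<in> range (\<lambda>g. S g b)" for z
      using that F(2) F'(2) \<phi>(2) by auto
    ultimately have "(F \<circ> \<phi>) y = F' y"
      using forall_in_closure_of_eq[OF _ Hausdorff_space_euclidean
          continuous_map_compose[OF \<phi>(1) F(1)] F'(1)] by blast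
    then show ?thesis by simp
  qed
  then show thesis
    using that factor_map_from_orbit_correspondence[OF Y(1) b(1) X(1) a(1) \<phi>] by blast
qed

section \<open>Furstenberg systems as factors, and their uniqueness\<close>

lemma Furstenberg_system_factor:
  assumes "Furstenberg_system f X T" "generalised_Furstenberg_system f Y S"
  shows "is_factor_of X T Y S"
proof -
  obtain F a where X: "dynamical_system X T" "represents f X T F a"
      and sep: "\<forall>x\<in>topspace X. \<forall>y\<in>topspace X. x \<noteq> y \<longrightarrow> (\<exists>g. F (T g x) \<noteq> F (T g y))"
    using assms(1) unfolding Furstenberg_system_def by blast
  obtain F' b where Y: "dynamical_system Y S" "represents f Y S F' b"
    using assms(2) unfolding generalised_Furstenberg_system_def by blast
  obtain \<phi> where "factor_map Y S X T \<phi>"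
    using factor_map_onto_separated_system[OF Y X] sep by metis
  then show ?thesis
    by (auto simp: is_factor_of_def)
qed

text \<open>Since \<open>F (T g x) = F' (S g (\<phi> x))\<close>, points with the same image under
  the factor map are not separated by \<open>F\<close> along their orbits, hence equal. A continuous
  bijection from a compact space to a Hausdorff space is a homeomorphism.\<close>

lemma Furstenberg_systems_isomorphic:
  assumes "Furstenberg_system f X T" "Furstenberg_system f Y S"
  shows "topologically_isomorphic X T Y S"
proof -
  obtain F a F' b where X: "dynamical_system X T" "represents f X T F a"
      and sepX: "\<forall>x\<in>topspace X. \<forall>y\<in>topspace X. x \<noteq> y \<longrightarrow> (\<exists>g. F (T g x) \<noteq> F (T g y))"
      and Y: "dynamical_system Y S" "represents f Y S F' b"
      and sepY: "\<forall>x\<in>topspace Y. \<forall>y\<in>topspace Y. x \<noteq> y \<longrightarrow> (\<exists>g. F' (S g x) \<noteq> F' (S g y))"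
    using assms unfolding Furstenberg_system_def by metis
  obtain \<phi> where \<phi>: "factor_map X T Y S \<phi>"
      and F: "\<And>x. x \<in> topspace X \<Longrightarrow> F' (\<phi> x) = F x"
    using factor_map_onto_separated_system[OF X Y] sepY by metis
  have cont: "continuous_map X Y \<phi>" and surj: "\<phi> ` topspace X = topspace Y"
    and equi: "\<And>g x. x \<in> topspace X \<Longrightarrow> \<phi> (T g x) = S g (\<phi> x)"
    using \<phi> by (auto simp: factor_map_def)
  have T: "T g x \<in> topspace X" if "x \<in> topspace X" for g x
    using X(1) that by (rule dynamical_system_in_topspace)
  have "inj_on \<phi> (topspace X)"
  proof (rule inj_onI)
    fix x y assume xy: "x \<in> topspace X" "y \<in> topspace X" "\<phi> x = \<phi> y"
    then have "F (T g x) = F (T g y)" for g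
      using F[OF T] equi by metis
    then show "x = y"
      using sepX xy by blast
  qed
  moreover have "closed_map X Y \<phi>"
    using X(1) Y(1) cont continuous_imp_closed_map_gen Hausdorff_imp_kc_space
    unfolding dynamical_system_def by blast
  ultimately have "homeomorphic_map X Y \<phi>"
    using cont surj by (simp add: bijective_closed_imp_homeomorphic_map)
  then show ?thesis
    using equi unfolding topologically_isomorphic_def by blast
qed

section \<open>The cube of indicator functions\<close>

text \<open>
  Sets are identified with their indicator functions, so that the cube \<open>{0,1}\<close> to the power
  \<open>'g set\<close> lives on the type \<open>'g set set\<close>.
\<close>

definition powerset_topology :: "'i set topology" where
  "powerset_topology =
     pullback_topology UNIV (\<lambda>p i. i \<in> p) (product_topology (\<lambda>_. discrete_topology UNIV) UNIV)"

lemma topspace_powerset_topology [simp]: "topspace powerset_topology = UNIV"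
  by (auto simp: powerset_topology_def topspace_pullback_topology)

text \<open>This is the universal property of the product: continuity is tested on each coordinate,
  here membership of a fixed \<open>i\<close>.\<close>

lemma continuous_map_into_powerset_topology:
  "continuous_map X powerset_topology q \<longleftrightarrow>
     (\<forall>i. continuous_map X (discrete_topology UNIV) (\<lambda>x. i \<in> q x))" (is "?L \<longleftrightarrow> ?R")
proof
  assume ?L
  moreover have "continuous_map powerset_topology
      (product_topology (\<lambda>_. discrete_topology UNIV) UNIV) (id \<circ> (\<lambda>p i. i \<in> p))"
    unfolding powerset_topology_def by (rule continuous_map_pullback[OF continuous_map_id])
  ultimately have "continuous_map X (product_topology (\<lambda>_. discrete_topology UNIV) UNIV)
      ((id \<circ> (\<lambda>p i. i \<in> p)) \<circ> q)"
    by (rule continuous_map_compose)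
  then show ?R
    by (simp add: continuous_map_componentwise_UNIV o_def)
next
  assume ?R
  then show ?L
    unfolding powerset_topology_def
    by (intro continuous_map_pullback') (auto simp: continuous_map_componentwise_UNIV o_def)
qed

lemma continuous_map_membership:
  "continuous_map powerset_topology (discrete_topology UNIV) (\<lambda>p. i \<in> p)"
  using continuous_map_into_powerset_topology[of "powerset_topology :: 'a set topology" id]
  by (simp add: id_def)

lemma openin_powerset_topology_membership:
  "openin powerset_topology {p. (i \<in> p) = c}"
  using openin_continuous_map_preimage[OF continuous_map_membership[of i], of "{c}"] by simp

text \<open>Transfers compactness (Tychonoff) and the Hausdorff property from the product.\<close>

lemma homeomorphic_powerset_topology:
  "(powerset_topology :: 'i set topology) homeomorphic_space
     product_topology (\<lambda>_::'i. discrete_topology (UNIV :: bool set)) UNIV"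
proof -
  have "continuous_map (powerset_topology :: 'i set topology)
      (product_topology (\<lambda>_. discrete_topology UNIV) UNIV) (\<lambda>p i. i \<in> p)"
    by (simp add: continuous_map_componentwise_UNIV continuous_map_membership)
  moreover have "continuous_map (product_topology (\<lambda>_::'i. discrete_topology UNIV) UNIV)
      powerset_topology Collect"
    using continuous_map_product_projection[of _ "UNIV :: 'i set" "\<lambda>_. discrete_topology (UNIV :: bool set)"]
    by (simp add: continuous_map_into_powerset_topology)
  ultimately have "homeomorphic_maps (powerset_topology :: 'i set topology)
      (product_topology (\<lambda>_::'i. discrete_topology UNIV) UNIV) (\<lambda>p i. i \<in> p) Collect"
    by (simp add: homeomorphic_maps_def)
  then show ?thesis
    by (rule homeomorphic_maps_imp_homeomorphic_space)
qed

lemma compact_space_powerset_topology: "compact_space powerset_topology"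
  using homeomorphic_compact_space[OF homeomorphic_powerset_topology]
  by (simp add: compact_space_product_topology compact_space_discrete_topology)

lemma Hausdorff_space_powerset_topology: "Hausdorff_space powerset_topology"
  using homeomorphic_Hausdorff_space[OF homeomorphic_powerset_topology]
  by (simp add: Hausdorff_space_product_topology Hausdorff_space_discrete_topology)

section \<open>The Stone-Cech compactification of the discrete semigroup\<close>

definition principal_ultrafilter :: "'g \<Rightarrow> 'g set set" where
  "principal_ultrafilter g = {A. g \<in> A}"

text \<open>
  The points of this space are the ultrafilters on \<open>'g\<close>, but only the density of the principal
  ones is ever needed.
\<close>

definition Stone_Cech :: "'g set set topology" where
  "Stone_Cech =
     subtopology powerset_topology (powerset_topology closure_of range principal_ultrafilter)"

text \<open>This is the pushforward of an ultrafilter under left multiplication by \<open>g\<close>.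
  The formula makes sense for every family \<open>p\<close>, so the action laws hold on the whole
  cube.\<close>

definition Stone_Cech_action :: "'g::monoid_mult \<Rightarrow> 'g set set \<Rightarrow> 'g set set" where
  "Stone_Cech_action g p = {A. {h. g * h \<in> A} \<in> p}"

lemma topspace_Stone_Cech:
  "topspace Stone_Cech = powerset_topology closure_of range principal_ultrafilter"
  by (simp add: Stone_Cech_def)

lemma principal_ultrafilter_in_Stone_Cech: "range principal_ultrafilter \<subseteq> topspace Stone_Cech"
  by (simp add: topspace_Stone_Cech closure_of_subset)

lemma Stone_Cech_dense: "Stone_Cech closure_of range principal_ultrafilter = topspace Stone_Cech"
  unfolding topspace_Stone_Cech
  unfolding Stone_Cech_def closure_of_subtopology
  by (simp only: Int_absorb1[OF principal_ultrafilter_in_Stone_Cech[unfolded topspace_Stone_Cech]] Int_absorb)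

lemma compact_space_Stone_Cech: "compact_space Stone_Cech"
  unfolding Stone_Cech_def
  by (rule compact_space_subtopology
      [OF closedin_compact_space[OF compact_space_powerset_topology closedin_closure_of]])

lemma Hausdorff_space_Stone_Cech: "Hausdorff_space Stone_Cech"
  by (simp add: Stone_Cech_def Hausdorff_space_subtopology Hausdorff_space_powerset_topology)

text \<open>The closure of the graph of \<open>v\<close> is single-valued: two limits over the same
  \<open>p\<close> would have disjoint neighbourhoods, and whether the preimage of one of them
  belongs to \<open>p\<close> cannot suit both.\<close>

lemma Stone_Cech_extension:
  assumes Y: "compact_space Y" "Hausdorff_space Y" and v: "range v \<subseteq> topspace Y"
  obtains \<phi> where "continuous_map Stone_Cech Y \<phi>" "\<And>g. \<phi> (principal_ultrafilter g) = v g"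
proof (rule continuous_extension_of_single_valued_closure
    [OF Y(1) principal_ultrafilter_in_Stone_Cech Stone_Cech_dense v])
  let ?P = "prod_topology Stone_Cech Y" and ?D = "range (\<lambda>g. (principal_ultrafilter g, v g))"
  fix p y y' assume py: "(p, y) \<in> ?P closure_of ?D" and py': "(p, y') \<in> ?P closure_of ?D"
  \<comment> \<open>Fixing the single coordinate \<open>A\<close> gives an open neighbourhood of
    \<open>p\<close>; its product with \<open>W\<close> meets the graph, and \<open>A\<close>
    belongs to \<open>principal_ultrafilter g\<close> exactly when \<open>g\<close> is in
    \<open>A\<close>.\<close>
  have meets: "\<exists>g. (g \<in> A) = (A \<in> p) \<and> v g \<in> W"
    if z: "(p, z) \<in> ?P closure_of ?D" and W: "openin Y W" "z \<in> W" for z A W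
  proof -
    have "openin Stone_Cech (topspace Stone_Cech \<inter> {q. (A \<in> q) = (A \<in> p)})"
      unfolding topspace_Stone_Cech unfolding Stone_Cech_def
      by (rule openin_subtopology_Int2[OF openin_powerset_topology_membership])
    then have "openin ?P ((topspace Stone_Cech \<inter> {q. (A \<in> q) = (A \<in> p)}) \<times> W)"
      using W(1) by (simp add: openin_prod_Times_iff)
    moreover have "(p, z) \<in> (topspace Stone_Cech \<inter> {q. (A \<in> q) = (A \<in> p)}) \<times> W"
      using z W(2) closure_of_subset_topspace[of ?P ?D] by auto
    ultimately obtain d where "d \<in> ?D" "d \<in> (topspace Stone_Cech \<inter> {q. (A \<in> q) = (A \<in> p)}) \<times> W"
      using z unfolding in_closure_of by meson
    then show ?thesis
      by (auto simp: principal_ultrafilter_def)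
  qed
  show "y = y'"
  proof (rule ccontr)
    assume "y \<noteq> y'"
    moreover have "y \<in> topspace Y" "y' \<in> topspace Y"
      using py py' closure_of_subset_topspace[of ?P ?D] by auto
    ultimately obtain V V' where V: "openin Y V" "y \<in> V" and V': "openin Y V'" "y' \<in> V'"
        and "disjnt V V'"
      using Y(2) unfolding Hausdorff_space_def by metis
    \<comment> \<open>The first claim forces the preimage of \<open>V\<close> into \<open>p\<close>;
      the second then gives a \<open>g\<close> with \<open>v g\<close> in both \<open>V\<close> and
      \<open>V'\<close>.\<close>
    moreover have "\<exists>g. (v g \<in> V) = ({g. v g \<in> V} \<in> p) \<and> v g \<in> V"
        "\<exists>g. (v g \<in> V) = ({g. v g \<in> V} \<in> p) \<and> v g \<in> V'"
      using meets[OF py V, of "{g. v g \<in> V}"] meets[OF py' V', of "{g. v g \<in> V}"] by auto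
    ultimately show False
      by (auto simp: disjnt_iff)
  qed
qed (rule that)

lemma Stone_Cech_action_principal [simp]:
  "Stone_Cech_action g (principal_ultrafilter h) = principal_ultrafilter (g * h)"
  by (simp add: Stone_Cech_action_def principal_ultrafilter_def)

lemma dynamical_system_Stone_Cech: "dynamical_system Stone_Cech Stone_Cech_action"
  unfolding dynamical_system_def
proof (intro conjI allI ballI)
  fix g :: 'a and h :: 'a and p :: "'a set set"
  show "Stone_Cech_action (g * h) p = Stone_Cech_action g (Stone_Cech_action h p)"
    "Stone_Cech_action 1 p = p"
    by (simp_all add: Stone_Cech_action_def mult.assoc)
  have cont: "continuous_map powerset_topology powerset_topology (Stone_Cech_action g)"
    by (simp add: continuous_map_into_powerset_topology Stone_Cech_action_def continuous_map_membership)
  \<comment> \<open>The action sends principal ultrafilters to principal ones, so by continuity it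
    preserves the closure of their range.\<close>
  have "Stone_Cech_action g ` (powerset_topology closure_of range principal_ultrafilter)
      \<subseteq> powerset_topology closure_of (Stone_Cech_action g ` range principal_ultrafilter)"
    by (rule continuous_map_image_closure_subset[OF cont])
  also have "\<dots> \<subseteq> powerset_topology closure_of range principal_ultrafilter"
    by (rule closure_of_mono) auto
  finally show "continuous_map Stone_Cech Stone_Cech (Stone_Cech_action g)"
    unfolding Stone_Cech_def
    by (intro continuous_map_into_subtopology continuous_map_from_subtopology cont) auto
qed (rule compact_space_Stone_Cech Hausdorff_space_Stone_Cech)+

lemma transitive_point_Stone_Cech:
  "transitive_point Stone_Cech Stone_Cech_action (principal_ultrafilter 1)"
  using principal_ultrafilter_in_Stone_Cech Stone_Cech_dense
  by (auto simp: transitive_point_def)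

section \<open>The maximal generalised Furstenberg system\<close>

text \<open>Boundedness makes the closure of the range of \<open>f\<close> a compact Hausdorff
  target, to which \<open>f\<close> extends; the transitive point is the principal ultrafilter at
  the identity.\<close>

lemma Stone_Cech_generalised_Furstenberg_system:
  fixes f :: "'g::monoid_mult \<Rightarrow> complex"
  assumes "bounded (range f)"
  shows "generalised_Furstenberg_system f Stone_Cech Stone_Cech_action"
proof -
  let ?K = "subtopology euclidean (closure (range f))"
  have "compact_space ?K"
    using assms by (simp add: compact_space_subtopology compactin_euclidean_iff compact_closure)
  moreover have "Hausdorff_space ?K"
    by (simp add: Hausdorff_space_subtopology Hausdorff_space_euclidean)
  moreover have "range f \<subseteq> topspace ?K"
    by (simp add: closure_subset)
  ultimately obtain F where F: "continuous_map Stone_Cech ?K F" "\<And>g. F (principal_ultrafilter g) = f g"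
    using Stone_Cech_extension by metis
  then have "represents f Stone_Cech Stone_Cech_action F (principal_ultrafilter 1)"
    by (simp add: represents_def transitive_point_Stone_Cech continuous_map_in_subtopology)
  then show ?thesis
    unfolding generalised_Furstenberg_system_def using dynamical_system_Stone_Cech by blast
qed

text \<open>The factor map is the extension of the orbit map of a transitive point of
  \<open>Y\<close>.\<close>

lemma Stone_Cech_factor:
  assumes "generalised_Furstenberg_system f Y S"
  shows "is_factor_of Y S Stone_Cech Stone_Cech_action"
proof -
  obtain b where Y: "dynamical_system Y S" and b: "transitive_point Y S b"
    using assms by (auto simp: generalised_Furstenberg_system_def represents_def)
  have "compact_space Y" "Hausdorff_space Y"
    using Y by (simp_all add: dynamical_system_def)
  moreover have "range (\<lambda>g. S g b) \<subseteq> topspace Y"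
    using b dynamical_system_in_topspace[OF Y] by (auto simp: transitive_point_def)
  ultimately obtain \<phi> where "continuous_map Stone_Cech Y \<phi>" "\<And>g. \<phi> (principal_ultrafilter g) = S g b"
    using Stone_Cech_extension[of Y "\<lambda>g. S g b"] by metis
  then show ?thesis
    using factor_map_from_orbit_correspondence
        [OF dynamical_system_Stone_Cech transitive_point_Stone_Cech Y b, of \<phi>]
    unfolding is_factor_of_def by auto
qed

lemma is_factor_of_trans:
  assumes "is_factor_of Z U Y S" "is_factor_of Y S X T"
  shows "is_factor_of Z U X T"
proof -
  obtain \<psi> \<phi> where \<psi>: "factor_map Y S Z U \<psi>" and \<phi>: "factor_map X T Y S \<phi>"
    using assms by (auto simp: is_factor_of_def)
  have "factor_map X T Z U (\<psi> \<circ> \<phi>)"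
    unfolding factor_map_def
  proof (intro conjI allI ballI)
    show "continuous_map X Z (\<psi> \<circ> \<phi>)"
      using \<phi> \<psi> unfolding factor_map_def by (blast intro: continuous_map_compose)
    show "(\<psi> \<circ> \<phi>) ` topspace X = topspace Z"
      using \<phi> \<psi> unfolding factor_map_def by (metis image_comp)
    show "(\<psi> \<circ> \<phi>) (T g x) = U g ((\<psi> \<circ> \<phi>) x)" if "x \<in> topspace X" for g x
    proof -
      have "\<phi> x \<in> topspace Y" "\<phi> (T g x) = S g (\<phi> x)"
        using \<phi> that unfolding factor_map_def by blast+
      then show ?thesis
        using \<psi> by (simp add: factor_map_def)
    qed
  qed
  then show ?thesis
    by (auto simp: is_factor_of_def)
qed

theorem theorem1p2:
  fixes f :: "'g::monoid_mult \<Rightarrow> complex"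
  assumes "bounded (range f)"
  shows
    "(\<forall>(X :: 'x topology) T (Y :: 'y topology) S.
        Furstenberg_system f X T \<and> Furstenberg_system f Y S \<longrightarrow>
        topologically_isomorphic X T Y S) \<and>
     (\<forall>(X :: 'x topology) T (Y :: 'y topology) S.
        Furstenberg_system f X T \<and> generalised_Furstenberg_system f Y S \<longrightarrow>
        is_factor_of X T Y S) \<and>
     (\<exists>(M :: 'g set set topology) R.
        maximal_generalised_Furstenberg_system TYPE('g set set) f M R) \<and>
     (\<forall>(M :: 'g set set topology) R.
        maximal_generalised_Furstenberg_system TYPE('g set set) f M R \<longrightarrow>
        maximal_generalised_Furstenberg_system TYPE('y) f M R)"
proof (intro conjI allI impI)
  note SC = Stone_Cech_generalised_Furstenberg_system[OF assms]
  show "topologically_isomorphic X T Y S"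
    if "Furstenberg_system f X T \<and> Furstenberg_system f Y S"
    for X :: "'x topology" and T and Y :: "'y topology" and S
    using that Furstenberg_systems_isomorphic by blast
  show "is_factor_of X T Y S"
    if "Furstenberg_system f X T \<and> generalised_Furstenberg_system f Y S"
    for X :: "'x topology" and T and Y :: "'y topology" and S
    using that Furstenberg_system_factor by blast
  show "\<exists>(M :: 'g set set topology) R. maximal_generalised_Furstenberg_system TYPE('g set set) f M R"
    using SC Stone_Cech_factor unfolding maximal_generalised_Furstenberg_system_def by blast
  show "maximal_generalised_Furstenberg_system TYPE('y) f M R"
    if max: "maximal_generalised_Furstenberg_system TYPE('g set set) f M R"
    for M :: "'g set set topology" and R
  proof -
    \<comment> \<open>The Stone-Cech system has its points in \<open>'g set set\<close>, so it is
      itself a factor of \<open>M\<close>; composing factor maps then reaches systems on any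
      type.\<close>
    have M: "generalised_Furstenberg_system f M R"
      and "is_factor_of Stone_Cech Stone_Cech_action M R"
      using max SC unfolding maximal_generalised_Furstenberg_system_def by blast+
    then show ?thesis
      unfolding maximal_generalised_Furstenberg_system_def
      using Stone_Cech_factor is_factor_of_trans by metis
  qed
qed

end
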